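(* The map $\Psi$ induces a $\mathbb{Q}(\mathbf{t})$-linear isomorphism $\Psi:\mathbf{f}[\mathbf{t}]|_{\pi=1}\rightarrow\mathbf{f}[\mathbf{t}]|_{\pi=-1}$.
   Context: Datum. $(I,\cdot)$ is a bar-consistent super Cartan datum of anisotropic type: $I$ is a finite set with a $\mathbb{Z}$-valued symmetric bilinear form $\cdot$ on the free abelian group $\mathbb{Z}[I]$ such that $d_i=\frac{i\cdot i}{2}\in\mathbb{Z}_{>0}$ for all $i\in I$ and $a_{ij}=2\frac{i\cdot j}{i\cdot i}\in\mathbb{Z}_{\le 0}$ for $i\ne j$ (for $i=j$ the same formula gives $a_{ii}=2$); there is a partition $I=I_{\bar 0}\sqcup I_{\bar 1}$ with $I_{\bar1}\neq\emptyset$, with parity $p(i)=0$ for $i\in I_{\bar 0}$ and $p(i)=1$ for $i\in I_{\bar 1}$; $a_{ij}\in 2\mathbb{Z}$ for $i\in I_{\bar 1}$, $j\in I$; and $d_i\equiv p(i)\bmod 2$ for all $i$. Put $b_{ij}=1-a_{ij}$. Fix a total order $<$ on $I$. Scalars. $v$ is a formal parameter, $\pi$ an indeterminate with $\pi^2=1$; for a ring $R$, $R^\pi=R[\pi]/(\pi^2-1)$. $\mathbf{t}$ is a square root of $-1$. Put $v_i=v^{d_i}$, $\pi_i=\pi^{d_i}$ and $\begin{bmatrix}n\\k\end{bmatrix}_{v,\pi}=\frac{\prod_{l=n-k+1}^n((\pi v)^l-v^{-l})}{\prod_{l=1}^k((\pi v)^l-v^{-l})}$. For an $R^\pi$-module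 $M$, the specialization is $M|_{\pi=\pm1}=R_\pm\otimes_{R^\pi}M$, where $R_\pm=R$ with $\pi$ acting as $\pm1$; when $\frac12\in R$ it is identified with $\varepsilon_\pm M$, $\varepsilon_\pm=\frac{1\pm\pi}{2}$. Half covering quantum group. $\mathbf{f}$ is the $\mathbb{Q}(v)^\pi$-algebra with generators $\theta_i$ ($i\in I$) and relations, for all $i\neq j$ in $I$, $\sum_{k=0}^{b_{ij}}(-1)^k\pi^{\binom{k}{2}p(i)+kp(i)p(j)}\begin{bmatrix}b_{ij}\\k\end{bmatrix}_{v_i,\pi_i}\theta_i^{b_{ij}-k}\theta_j\theta_i^k=0$. It is $\mathbb{Z}[I]$-graded by $|\theta_i|=i$. Set $\mathbf{f}[\mathbf{t}]=\mathbb{Q}(v,\mathbf{t})^\pi\otimes_{\mathbb{Q}(v)^\pi}\mathbf{f}$. Twistor. Let $\phi:\mathbb{Z}[I]\times\mathbb{Z}[I]\to\mathbb{Z}$ be the bilinear form with $\phi(i,j)=d_ia_{ij}$ if $j<i$, $\phi(i,i)=d_i$, $\phi(i,j)=-2p(i)p(j)$ if $j>i$. Let $*$ be the associative product on $\mathbf{f}[\mathbf{t}]$ determined bilinearly by $x*y=\mathbf{t}^{\phi(|x|,|y|)}xy$ for homogeneous $x,y$. The twistor $\Psi:\mathbf{f}[\mathbf{t}]\to(\mathbf{f}[\mathbf{t}],* )$ is the $\mathbb{Q}(\mathbf{t})$-algebra isomorphism with $\Psi(\theta_i)=\theta_i$, $\Psi(v)=\mathbf{t}^{-1}v$, $\Psi(\pi)=-\pi$,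 $\Psi(xy)=\Psi(x)*\Psi(y)$. *)

theory Defs
  imports
    "HOL-Algebra.Free_Abelian_Groups"
    "HOL-Algebra.Algebraic_Closure_Type"
    "HOL-Algebra.Module"
begin

section \<open>Scalars\<close>

text \<open>
  The ring \<open>R[\<pi>]/(\<pi>\<^sup>2 - 1)\<close>; \<open>PiExt a b\<close> is \<open>a + b \<pi>\<close>.
\<close>

datatype 'a pi_ext = PiExt (pi_fst: 'a) (pi_snd: 'a)

instantiation pi_ext :: (comm_ring_1) comm_ring_1
begin

definition "0 = PiExt 0 0"
definition "1 = PiExt 1 0"
definition "x + y = PiExt (pi_fst x + pi_fst y) (pi_snd x + pi_snd y)"
definition "- x = PiExt (- pi_fst x) (- pi_snd x)"
definition "x - y = PiExt (pi_fst x - pi_fst y) (pi_snd x - pi_snd y)"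
definition "x * y = PiExt (pi_fst x * pi_fst y + pi_snd x * pi_snd y)
                          (pi_fst x * pi_snd y + pi_snd x * pi_fst y)"

instance
  by standard
    (simp_all add: zero_pi_ext_def one_pi_ext_def plus_pi_ext_def uminus_pi_ext_def
      minus_pi_ext_def times_pi_ext_def algebra_simps)

end

text \<open>
  Over a field, \<open>a + b \<pi>\<close> is a unit iff \<open>a\<^sup>2 - b\<^sup>2 \<noteq> 0\<close>; non-units get the inverse \<open>0\<close>.
\<close>

instantiation pi_ext :: (field) inverse
begin

definition "inverse x =
  PiExt (pi_fst x / ((pi_fst x)\<^sup>2 - (pi_snd x)\<^sup>2)) (- pi_snd x / ((pi_fst x)\<^sup>2 - (pi_snd x)\<^sup>2))"
definition "x div y = x * inverse (y :: 'a pi_ext)"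

instance ..

end

lemma pi_ext_right_inverse:
  fixes x :: "'a::field pi_ext"
  assumes "(pi_fst x)\<^sup>2 \<noteq> (pi_snd x)\<^sup>2"
  shows "x * inverse x = 1"
  using assms
  by (simp add: inverse_pi_ext_def times_pi_ext_def one_pi_ext_def divide_simps)
     (simp add: algebra_simps power2_eq_square)

text \<open>
  The ring \<open>R[t]/(t\<^sup>2 + 1)\<close>; \<open>IExt a b\<close> is \<open>a + b t\<close>.  It is a field if \<open>R\<close> is an
  ordered field, which covers \<open>\<rat>\<close> and \<open>\<rat>(v)\<close>.
\<close>

datatype 'a i_ext = IExt (i_fst: 'a) (i_snd: 'a)

instantiation i_ext :: (comm_ring_1) comm_ring_1
begin

definition "0 = IExt 0 0"
definition "1 = IExt 1 0"
definition "x + y = IExt (i_fst x + i_fst y) (i_snd x + i_snd y)"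
definition "- x = IExt (- i_fst x) (- i_snd x)"
definition "x - y = IExt (i_fst x - i_fst y) (i_snd x - i_snd y)"
definition "x * y = IExt (i_fst x * i_fst y - i_snd x * i_snd y)
                         (i_fst x * i_snd y + i_snd x * i_fst y)"

instance
  by standard
    (simp_all add: zero_i_ext_def one_i_ext_def plus_i_ext_def uminus_i_ext_def
      minus_i_ext_def times_i_ext_def algebra_simps)

end

instantiation i_ext :: (linordered_field) field
begin

definition "inverse x =
  IExt (i_fst x / ((i_fst x)\<^sup>2 + (i_snd x)\<^sup>2)) (- i_snd x / ((i_fst x)\<^sup>2 + (i_snd x)\<^sup>2))"
definition "x div y = x * inverse (y :: 'a i_ext)"

instance
proof
  fix x :: "'a i_ext"
  assume "x \<noteq> 0"
  then have "(i_fst x)\<^sup>2 + (i_snd x)\<^sup>2 \<noteq> 0"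
    by (cases x) (auto simp: zero_i_ext_def sum_power2_eq_zero_iff)
  then show "inverse x * x = 1"
    by (simp add: inverse_i_ext_def times_i_ext_def one_i_ext_def divide_simps)
       (simp add: algebra_simps power2_eq_square)
qed (simp_all add: divide_i_ext_def inverse_i_ext_def zero_i_ext_def)

end

type_synonym Qt = "rat i_ext"               \<comment> \<open>\<open>\<rat>(t)\<close>\<close>
type_synonym Qv = "rat poly fract"          \<comment> \<open>\<open>\<rat>(v)\<close>\<close>
type_synonym Qvt = "rat poly fract i_ext"   \<comment> \<open>\<open>\<rat>(v,t) = \<rat>(v)[t]/(t\<^sup>2 + 1)\<close>\<close>

definition v_Qv :: Qv
  where "v_Qv = Fract [:0, 1:] 1"

definition t_Qvt :: Qvt
  where "t_Qvt = IExt 0 1"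

definition const :: "'a::zero \<Rightarrow> 'a pi_ext"
  where "const a = PiExt a 0"

definition pi_elem :: "'a::zero_neq_one pi_ext"
  where "pi_elem = PiExt 0 1"

definition Qv_Qvt :: "Qv \<Rightarrow> Qvt"
  where "Qv_Qvt a = IExt a 0"

definition Qt_Qvt :: "Qt \<Rightarrow> Qvt"
  where "Qt_Qvt = map_i_ext (\<lambda>q. Fract [:q:] 1)"

definition qbinom :: "'a::{comm_ring_1, inverse} \<Rightarrow> 'a \<Rightarrow> nat \<Rightarrow> nat \<Rightarrow> 'a"
  where "qbinom u p n k =
    (\<Prod>l = n - k + 1..n. (p * u) ^ l - inverse u ^ l) / (\<Prod>l = 1..k. (p * u) ^ l - inverse u ^ l)"


section \<open>Extension of scalars\<close>

text \<open>
  \<open>tensor \<alpha> M\<close> is \<open>A \<otimes>\<^sub>B M\<close> for a \<open>B\<close>-algebra \<open>M\<close> and a homomorphism \<open>\<alpha> : B \<rightarrow> A\<close> of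
  commutative rings (both being types).  Its elements are the cosets, in the free abelian group on
  \<open>A \<times> M\<close>, of the subgroup generated by the usual relators.  The \<open>A\<close>-action and the product
  are \<open>r (a \<otimes> x) = (r a) \<otimes> x\<close> and \<open>(a \<otimes> x) (b \<otimes> y) = (a b) \<otimes> (x y)\<close>, given on cosets
  through representatives in the style of \<^const>\<open>rcoset_mult\<close>.
\<close>

definition tensor_free :: "('b, 'c) module \<Rightarrow> (('a \<times> 'c) \<Rightarrow>\<^sub>0 int) monoid"
  where "tensor_free M = free_Abelian_group (UNIV \<times> carrier M)"

definition tensor_relators ::
    "('b \<Rightarrow> 'a::comm_ring_1) \<Rightarrow> ('b, 'c) module \<Rightarrow> (('a \<times> 'c) \<Rightarrow>\<^sub>0 int) set"
  where "tensor_relators \<alpha> M =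
    {frag_of (a + b, x) - frag_of (a, x) - frag_of (b, x) |a b x. x \<in> carrier M} \<union>
    {frag_of (a, x \<oplus>\<^bsub>M\<^esub> y) - frag_of (a, x) - frag_of (a, y) |a x y.
       x \<in> carrier M \<and> y \<in> carrier M} \<union>
    {frag_of (a * \<alpha> b, x) - frag_of (a, b \<odot>\<^bsub>M\<^esub> x) |a b x. x \<in> carrier M}"

definition tensor_kernel ::
    "('b \<Rightarrow> 'a::comm_ring_1) \<Rightarrow> ('b, 'c) module \<Rightarrow> (('a \<times> 'c) \<Rightarrow>\<^sub>0 int) set"
  where "tensor_kernel \<alpha> M = generate (tensor_free M) (tensor_relators \<alpha> M)"

definition tensor_class ::
    "('b \<Rightarrow> 'a::comm_ring_1) \<Rightarrow> ('b, 'c) module \<Rightarrow> (('a \<times> 'c) \<Rightarrow>\<^sub>0 int) \<Rightarrow> (('a \<times> 'c) \<Rightarrow>\<^sub>0 int) set"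
  where "tensor_class \<alpha> M z = tensor_kernel \<alpha> M #>\<^bsub>tensor_free M\<^esub> z"

definition pure_tensor ::
    "('b \<Rightarrow> 'a::comm_ring_1) \<Rightarrow> ('b, 'c) module \<Rightarrow> 'a \<Rightarrow> 'c \<Rightarrow> (('a \<times> 'c) \<Rightarrow>\<^sub>0 int) set"
  where "pure_tensor \<alpha> M a x = tensor_class \<alpha> M (frag_of (a, x))"

definition tensor ::
    "('b \<Rightarrow> 'a::comm_ring_1) \<Rightarrow> ('b, 'c) module \<Rightarrow> ('a, (('a \<times> 'c) \<Rightarrow>\<^sub>0 int) set) module"
  where "tensor \<alpha> M =
    \<lparr>carrier = rcosets\<^bsub>tensor_free M\<^esub> (tensor_kernel \<alpha> M),
     monoid.mult = (\<lambda>U W. \<Union>z\<in>U. \<Union>w\<in>W. tensor_class \<alpha> M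
       (frag_extend (\<lambda>(a, x). frag_extend (\<lambda>(b, y). frag_of (a * b, x \<otimes>\<^bsub>M\<^esub> y)) w) z)),
     one = pure_tensor \<alpha> M 1 \<one>\<^bsub>M\<^esub>,
     ring.zero = tensor_kernel \<alpha> M,
     add = (<#>\<^bsub>tensor_free M\<^esub>),
     module.smult = (\<lambda>r U. \<Union>z\<in>U. tensor_class \<alpha> M (frag_extend (\<lambda>(a, x). frag_of (r * a, x)) z))\<rparr>"


section \<open>Specialization at \<open>\<pi> = 1\<close> and \<open>\<pi> = -1\<close>\<close>

text \<open>
  For \<open>s = 1\<close> or \<open>s = -1\<close>, \<open>eval_pi s\<close> is the structure map \<open>R\<^sup>\<pi> \<rightarrow> R\<close> of \<open>R\<^sub>+\<close> or \<open>R\<^sub>-\<close>.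
\<close>

definition eval_pi :: "'a::comm_ring_1 \<Rightarrow> 'a pi_ext \<Rightarrow> 'a"
  where "eval_pi s x = pi_fst x + pi_snd x * s"

definition specialization ::
    "'a::comm_ring_1 \<Rightarrow> ('a pi_ext, 'c) module \<Rightarrow> ('a, (('a \<times> 'c) \<Rightarrow>\<^sub>0 int) set) module"
  where "specialization s M = tensor (eval_pi s) M"

definition Qt_linear_iso :: "(Qvt, 'a) module \<Rightarrow> (Qvt, 'b) module \<Rightarrow> ('a \<Rightarrow> 'b) \<Rightarrow> bool"
  where "Qt_linear_iso M N h \<longleftrightarrow>
    h \<in> iso (add_monoid M) (add_monoid N) \<and>
    (\<forall>c. \<forall>x\<in>carrier M. h (Qt_Qvt c \<odot>\<^bsub>M\<^esub> x) = Qt_Qvt c \<odot>\<^bsub>N\<^esub> h x)"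


section \<open>Free associative algebras\<close>

text \<open>
  The free monoid on \<open>'i\<close>, written additively, so that \<open>'i free_monoid \<Rightarrow>\<^sub>0 'a\<close> with its
  convolution product is the free associative unital \<open>'a\<close>-algebra on \<open>'i\<close>.
\<close>

datatype 'i free_monoid = Word (letters: "'i list")

instantiation free_monoid :: (type) monoid_add
begin

definition "0 = Word []"
definition "x + y = Word (letters x @ letters y)"

instance
  by standard (simp_all add: zero_free_monoid_def plus_free_monoid_def)

end

definition gen :: "'i \<Rightarrow> 'i free_monoid \<Rightarrow>\<^sub>0 'a::zero_neq_one"
  where "gen i = Poly_Mapping.single (Word [i]) 1"

text \<open>An element of the root lattice \<open>\<int>[I]\<close> is given by its coordinates.\<close>

definition weight :: "'i free_monoid \<Rightarrow> 'i \<Rightarrow> int"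
  where "weight w i = int (count_list (letters w) i)"


section \<open>The half covering quantum group and its twistor\<close>

text \<open>
  The index set is the finite type \<open>'i\<close>, with the total order of its class.  The form on \<open>\<int>[I]\<close>
  is given by its values on the basis; \<open>I1\<close> is the set of odd indices.
\<close>

locale super_cartan_datum =
  fixes form :: "'i::{finite, linorder} \<Rightarrow> 'i \<Rightarrow> int" (infixl "\<cdot>" 70)
    and I1 :: "'i set"
  assumes form_sym: "i \<cdot> j = j \<cdot> i"
    and form_diag_even: "even (i \<cdot> i)"
    and form_diag_pos: "i \<cdot> i > 0"
    and cartan_integral: "i \<noteq> j \<Longrightarrow> i \<cdot> i dvd 2 * (i \<cdot> j)"
    and cartan_nonpos: "i \<noteq> j \<Longrightarrow> 2 * (i \<cdot> j) div (i \<cdot> i) \<le> 0"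
    and I1_nonempty: "I1 \<noteq> {}"
    and cartan_odd_even: "i \<in> I1 \<Longrightarrow> even (2 * (i \<cdot> j) div (i \<cdot> i))"
    and bar_consistent: "(i \<cdot> i div 2) mod 2 = (if i \<in> I1 then 1 else 0)"
begin

definition d :: "'i \<Rightarrow> nat"
  where "d i = nat (i \<cdot> i div 2)"

definition cartan :: "'i \<Rightarrow> 'i \<Rightarrow> int"
  where "cartan i j = 2 * (i \<cdot> j) div (i \<cdot> i)"

definition serre_len :: "'i \<Rightarrow> 'i \<Rightarrow> nat"
  where "serre_len i j = nat (1 - cartan i j)"

definition parity :: "'i \<Rightarrow> nat"
  where "parity i = (if i \<in> I1 then 1 else 0)"

definition serre :: "'i \<Rightarrow> 'i \<Rightarrow> 'i free_monoid \<Rightarrow>\<^sub>0 Qv pi_ext"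
  where "serre i j = (\<Sum>k = 0..serre_len i j.
    Poly_Mapping.single 0
      ((- 1) ^ k * pi_elem ^ ((k choose 2) * parity i + k * parity i * parity j) *
       qbinom (const v_Qv ^ d i) (pi_elem ^ d i) (serre_len i j) k) *
    gen i ^ (serre_len i j - k) * gen j * gen i ^ k)"

definition serre_ideal :: "('i free_monoid \<Rightarrow>\<^sub>0 Qv pi_ext) set"
  where "serre_ideal = genideal ring_of_type_algebra {serre i j |i j. i \<noteq> j}"

definition f_class :: "('i free_monoid \<Rightarrow>\<^sub>0 Qv pi_ext) \<Rightarrow> ('i free_monoid \<Rightarrow>\<^sub>0 Qv pi_ext) set"
  where "f_class x = serre_ideal +>\<^bsub>ring_of_type_algebra\<^esub> x"

definition \<f> :: "(Qv pi_ext, ('i free_monoid \<Rightarrow>\<^sub>0 Qv pi_ext) set) module"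
  where "\<f> = ring.extend (ring_of_type_algebra Quot serre_ideal)
    (module.fields (\<lambda>c U. \<Union>x\<in>U. f_class (Poly_Mapping.single 0 c * x)))"

definition f_deg :: "('i \<Rightarrow> int) \<Rightarrow> ('i free_monoid \<Rightarrow>\<^sub>0 Qv pi_ext) set set"
  where "f_deg \<nu> = {f_class x |x. \<forall>w \<in> Poly_Mapping.keys x. weight w = \<nu>}"

abbreviation (input) ext :: "Qv pi_ext \<Rightarrow> Qvt pi_ext"
  where "ext \<equiv> map_pi_ext Qv_Qvt"

definition ft ::
    "(Qvt pi_ext, ((Qvt pi_ext \<times> ('i free_monoid \<Rightarrow>\<^sub>0 Qv pi_ext) set) \<Rightarrow>\<^sub>0 int) set) module"
  where "ft = tensor ext \<f>"

definition ft_deg ::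
    "('i \<Rightarrow> int) \<Rightarrow> ((Qvt pi_ext \<times> ('i free_monoid \<Rightarrow>\<^sub>0 Qv pi_ext) set) \<Rightarrow>\<^sub>0 int) set set"
  where "ft_deg \<nu> = generate (add_monoid ft) {pure_tensor ext \<f> c x |c x. x \<in> f_deg \<nu>}"

definition \<theta> :: "'i \<Rightarrow> ((Qvt pi_ext \<times> ('i free_monoid \<Rightarrow>\<^sub>0 Qv pi_ext) set) \<Rightarrow>\<^sub>0 int) set"
  where "\<theta> i = pure_tensor ext \<f> 1 (f_class (gen i))"

definition \<phi>_basis :: "'i \<Rightarrow> 'i \<Rightarrow> int"
  where "\<phi>_basis i j =
    (if j < i then int (d i) * cartan i j else if i = j then int (d i) else - 2 * int (parity i * parity j))"

definition \<phi> :: "('i \<Rightarrow> int) \<Rightarrow> ('i \<Rightarrow> int) \<Rightarrow> int"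
  where "\<phi> \<mu> \<nu> = (\<Sum>i\<in>UNIV. \<Sum>j\<in>UNIV. \<mu> i * \<nu> j * \<phi>_basis i j)"

text \<open>
  \<open>twisted_product star\<close> and \<open>twistor star \<Psi>\<close> state the defining properties of the product \<open>*\<close>
  and of \<open>\<Psi> : f[t] \<rightarrow> (f[t], *)\<close>.  A scalar \<open>c\<close> is viewed in \<open>f[t]\<close> as \<open>c \<odot> \<one>\<close>.
\<close>

definition twisted_product where
  "twisted_product star \<longleftrightarrow>
    ring (ft\<lparr>monoid.mult := star\<rparr>) \<and>
    (\<forall>c. \<forall>x\<in>carrier ft. \<forall>y\<in>carrier ft.
      star (c \<odot>\<^bsub>ft\<^esub> x) y = c \<odot>\<^bsub>ft\<^esub> star x y \<and> star x (c \<odot>\<^bsub>ft\<^esub> y) = c \<odot>\<^bsub>ft\<^esub> star x y) \<and>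
    (\<forall>\<mu> \<nu>. \<forall>x\<in>ft_deg \<mu>. \<forall>y\<in>ft_deg \<nu>.
      star x y = const (t_Qvt powi \<phi> \<mu> \<nu>) \<odot>\<^bsub>ft\<^esub> (x \<otimes>\<^bsub>ft\<^esub> y))"

definition twistor where
  "twistor star \<Psi> \<longleftrightarrow>
    \<Psi> \<in> ring_iso ft (ft\<lparr>monoid.mult := star\<rparr>) \<and>
    (\<forall>c. \<forall>x\<in>carrier ft. \<Psi> (const (Qt_Qvt c) \<odot>\<^bsub>ft\<^esub> x) = const (Qt_Qvt c) \<odot>\<^bsub>ft\<^esub> \<Psi> x) \<and>
    (\<forall>i. \<Psi> (\<theta> i) = \<theta> i) \<and>
    \<Psi> (const (Qv_Qvt v_Qv) \<odot>\<^bsub>ft\<^esub> \<one>\<^bsub>ft\<^esub>) = const (inverse t_Qvt * Qv_Qvt v_Qv) \<odot>\<^bsub>ft\<^esub> \<one>\<^bsub>ft\<^esub> \<and>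
    \<Psi> (pi_elem \<odot>\<^bsub>ft\<^esub> \<one>\<^bsub>ft\<^esub>) = (- pi_elem) \<odot>\<^bsub>ft\<^esub> \<one>\<^bsub>ft\<^esub>"

end

end

theory Submission
  imports Defs
begin

text \<open>
  The specialization of an \<open>R\<^sup>\<pi>\<close>-module \<open>M\<close> at \<open>\<pi> = s\<close> is the quotient \<open>M / (\<pi> - s) M\<close>.  The
  twistor sends \<open>\<pi>\<close> to \<open>- \<pi>\<close>, so it carries \<open>(\<pi> - 1) x\<close> to \<open>- (\<pi> + 1) \<Psi> x\<close>; being bijective, it
  maps the submodule \<open>(\<pi> - 1) f[t]\<close> onto \<open>(\<pi> + 1) f[t]\<close> and hence induces a bijection between the
  two quotients.  Linearity over \<open>\<rat>(t)\<close> is inherited from \<open>\<Psi>\<close>, since the scalars of \<open>\<rat>(t)\<close> act on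
  a specialization through their action on \<open>f[t]\<close>.

  The description of the specialization as a quotient is \<open>specialization_map_surj\<close> together with
  \<open>specialization_map_eq_zero_iff\<close>, for the map \<open>x \<mapsto> 1 \<otimes> x\<close>.  The descent of an additive bijection
  that anticommutes with \<open>\<pi>\<close> is \<open>specialization_iso_of_pi_antilinear\<close>.  That the twistor has this
  property, \<open>twistor_pi_antilinear\<close>, follows from its multiplicativity and its value at \<open>\<pi> \<cdot> 1\<close>,
  once \<open>\<pi> x\<close> is known to be the product of \<open>\<pi> \<cdot> 1\<close> and \<open>x\<close> in \<open>f[t]\<close>; this is where the product
  of a tensor product of algebras has to be well defined (\<open>mult_tensor_class\<close>).
\<close>

section \<open>Modules over a ring that is a type\<close>

lemma ring_of_type_algebra_simps [simp]:
  "carrier ring_of_type_algebra = UNIV"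
  "x \<otimes>\<^bsub>ring_of_type_algebra\<^esub> y = x * y"
  "x \<oplus>\<^bsub>ring_of_type_algebra\<^esub> y = x + y"
  "\<one>\<^bsub>ring_of_type_algebra\<^esub> = 1"
  "\<zero>\<^bsub>ring_of_type_algebra\<^esub> = 0"
  by (simp_all add: ring_of_type_algebra_def)

lemma ring_ring_of_type_algebra: "ring (ring_of_type_algebra :: 'a::ring_1 ring)"
proof (rule ringI)
  show "abelian_group (ring_of_type_algebra :: 'a ring)"
    by (rule abelian_groupI) (auto simp: algebra_simps intro: exI[of _ "- x" for x])
qed (auto intro!: monoidI simp: algebra_simps)

lemma module_ring_of_type_algebraI:
  fixes M :: "('a::comm_ring_1, 'c) module"
  assumes "abelian_group M"
    and "\<And>a x. x \<in> carrier M \<Longrightarrow> a \<odot>\<^bsub>M\<^esub> x \<in> carrier M"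
    and "\<And>a b x. x \<in> carrier M \<Longrightarrow> (a + b) \<odot>\<^bsub>M\<^esub> x = a \<odot>\<^bsub>M\<^esub> x \<oplus>\<^bsub>M\<^esub> b \<odot>\<^bsub>M\<^esub> x"
    and "\<And>a x y. x \<in> carrier M \<Longrightarrow> y \<in> carrier M \<Longrightarrow>
      a \<odot>\<^bsub>M\<^esub> (x \<oplus>\<^bsub>M\<^esub> y) = a \<odot>\<^bsub>M\<^esub> x \<oplus>\<^bsub>M\<^esub> a \<odot>\<^bsub>M\<^esub> y"
    and "\<And>a b x. x \<in> carrier M \<Longrightarrow> (a * b) \<odot>\<^bsub>M\<^esub> x = a \<odot>\<^bsub>M\<^esub> (b \<odot>\<^bsub>M\<^esub> x)"
    and "\<And>x. x \<in> carrier M \<Longrightarrow> 1 \<odot>\<^bsub>M\<^esub> x = x"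
  shows "module ring_of_type_algebra M"
  by (rule moduleI) (use assms in \<open>auto simp: cring_from_type_algebra\<close>)

section \<open>Extension of scalars\<close>

context
  fixes \<alpha> :: "'b::comm_ring_1 \<Rightarrow> 'a::comm_ring_1" and M :: "('b, 'c) module"
  assumes M: "module ring_of_type_algebra M"
begin

interpretation M: module ring_of_type_algebra M
  by (fact M)

interpretation F: comm_group "tensor_free M"
  unfolding tensor_free_def by (rule abelian_free_Abelian_group)

lemma carrier_tensor_free: "z \<in> carrier (tensor_free M) \<longleftrightarrow> Poly_Mapping.keys z \<subseteq> UNIV \<times> carrier M"
  by (simp add: tensor_free_def)

lemma tensor_free_simps:
  "z \<otimes>\<^bsub>tensor_free M\<^esub> w = z + w" "\<one>\<^bsub>tensor_free M\<^esub> = 0"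
  "z \<in> carrier (tensor_free M) \<Longrightarrow> inv\<^bsub>tensor_free M\<^esub> z = - z"
  "frag_of (a, x) \<in> carrier (tensor_free M) \<longleftrightarrow> x \<in> carrier M"
  by (simp_all add: tensor_free_def)

lemma tensor_free_add_closed:
  "z \<in> carrier (tensor_free M) \<Longrightarrow> w \<in> carrier (tensor_free M) \<Longrightarrow> z + w \<in> carrier (tensor_free M)"
  using keys_add[of z w] by (auto simp: carrier_tensor_free)

lemma tensor_free_diff_closed:
  "z \<in> carrier (tensor_free M) \<Longrightarrow> w \<in> carrier (tensor_free M) \<Longrightarrow> z - w \<in> carrier (tensor_free M)"
  using keys_diff[of z w] by (auto simp: carrier_tensor_free)

lemma tensor_relators_subset: "tensor_relators \<alpha> M \<subseteq> carrier (tensor_free M)"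
  unfolding tensor_relators_def
  by (auto intro!: tensor_free_diff_closed M.smult_closed M.a_closed simp: tensor_free_simps)

lemma subgroup_tensor_kernel: "subgroup (tensor_kernel \<alpha> M) (tensor_free M)"
  unfolding tensor_kernel_def by (rule F.generate_is_subgroup[OF tensor_relators_subset])

interpretation K: subgroup "tensor_kernel \<alpha> M" "tensor_free M"
  by (rule subgroup_tensor_kernel)

lemma tensor_kernel_closed:
  "0 \<in> tensor_kernel \<alpha> M"
  "z \<in> tensor_kernel \<alpha> M \<Longrightarrow> w \<in> tensor_kernel \<alpha> M \<Longrightarrow> z + w \<in> tensor_kernel \<alpha> M"
  "z \<in> tensor_kernel \<alpha> M \<Longrightarrow> - z \<in> tensor_kernel \<alpha> M"
  "z \<in> tensor_kernel \<alpha> M \<Longrightarrow> w \<in> tensor_kernel \<alpha> M \<Longrightarrow> z - w \<in> tensor_kernel \<alpha> M"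
proof -
  show "0 \<in> tensor_kernel \<alpha> M"
    using K.one_closed by (simp add: tensor_free_simps)
  show add: "z + w \<in> tensor_kernel \<alpha> M" if "z \<in> tensor_kernel \<alpha> M" "w \<in> tensor_kernel \<alpha> M" for z w
    using K.m_closed[OF that] by (simp add: tensor_free_simps)
  show minus: "- z \<in> tensor_kernel \<alpha> M" if "z \<in> tensor_kernel \<alpha> M" for z
    using K.m_inv_closed[OF that] that by (simp add: tensor_free_simps K.mem_carrier)
  show "z - w \<in> tensor_kernel \<alpha> M" if "z \<in> tensor_kernel \<alpha> M" "w \<in> tensor_kernel \<alpha> M"
    using add[OF that(1) minus[OF that(2)]] by simp
qed

lemma relators_in_tensor_kernel:
  "x \<in> carrier M \<Longrightarrow> frag_of (a + b, x) - frag_of (a, x) - frag_of (b, x) \<in> tensor_kernel \<alpha> M"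
  "x \<in> carrier M \<Longrightarrow> y \<in> carrier M \<Longrightarrow>
    frag_of (a, x \<oplus>\<^bsub>M\<^esub> y) - frag_of (a, x) - frag_of (a, y) \<in> tensor_kernel \<alpha> M"
  "x \<in> carrier M \<Longrightarrow> frag_of (a * \<alpha> c, x) - frag_of (a, c \<odot>\<^bsub>M\<^esub> x) \<in> tensor_kernel \<alpha> M"
  unfolding tensor_kernel_def by (rule generate.incl, force simp: tensor_relators_def)+

text \<open>
  This is how maps out of the tensor product are obtained: a homomorphism on the free group need only
  be checked on the relators.
\<close>

lemma tensor_kernel_hom_image:
  assumes "group G" "g \<in> hom (tensor_free M) G" "subgroup L G"
    and "\<And>r. r \<in> tensor_relators \<alpha> M \<Longrightarrow> g r \<in> L" and "z \<in> tensor_kernel \<alpha> M"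
  shows "g z \<in> L"
proof -
  interpret g: group_hom "tensor_free M" G g
    using assms(1,2) by (simp add: group_hom_def group_hom_axioms_def F.group_axioms)
  interpret L: subgroup L G
    by fact
  have "z \<in> generate (tensor_free M) (tensor_relators \<alpha> M)"
    using assms(5) by (simp add: tensor_kernel_def)
  then show ?thesis
  proof induction
    case (inv h)
    then show ?case
      using tensor_relators_subset assms(4) by (auto simp: subset_iff)
  next
    case (eng h1 h2)
    then have "h1 \<in> carrier (tensor_free M)" "h2 \<in> carrier (tensor_free M)"
      by (meson F.generate_in_carrier tensor_relators_subset)+
    then show ?case
      using eng by simp
  qed (use assms(4) in auto)
qed

lemma frag_extend_hom_tensor_free:
  fixes f :: "'a \<times> 'c \<Rightarrow> 'a \<times> 'c \<Rightarrow>\<^sub>0 int"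
  assumes "\<And>a x. x \<in> carrier M \<Longrightarrow> f (a, x) \<in> carrier (tensor_free M)"
  shows "frag_extend f \<in> hom (tensor_free M) (tensor_free M)"
proof (rule homI)
  fix z :: "'a \<times> 'c \<Rightarrow>\<^sub>0 int"
  assume "z \<in> carrier (tensor_free M)"
  then have "Poly_Mapping.keys (f p) \<subseteq> UNIV \<times> carrier M" if "p \<in> Poly_Mapping.keys z" for p
    using assms[of "snd p" "fst p"] that by (force simp: carrier_tensor_free)
  then show "frag_extend f z \<in> carrier (tensor_free M)"
    using keys_frag_extend[of f z] unfolding carrier_tensor_free by (meson UN_least order_trans)
qed (simp add: tensor_free_simps frag_extend_add)

text \<open>
  The multiplication of the free group is addition in the ambient type, so cosets can be compared
  without restricting their representatives to the carrier.
\<close>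

lemma tensor_class_altdef: "tensor_class \<alpha> M z = (\<lambda>k. k + z) ` tensor_kernel \<alpha> M"
  by (auto simp: tensor_class_def r_coset_def tensor_free_simps)

lemma tensor_class_eq_iff: "tensor_class \<alpha> M z = tensor_class \<alpha> M w \<longleftrightarrow> z - w \<in> tensor_kernel \<alpha> M"
proof
  assume eq: "tensor_class \<alpha> M z = tensor_class \<alpha> M w"
  have "0 + z \<in> tensor_class \<alpha> M z"
    unfolding tensor_class_altdef using tensor_kernel_closed(1) by blast
  with eq show "z - w \<in> tensor_kernel \<alpha> M"
    by (auto simp: tensor_class_altdef)
next
  assume zw: "z - w \<in> tensor_kernel \<alpha> M"
  have "k + z = (k + (z - w)) + w" "k + w = (k - (z - w)) + z" for k
    by simp_all
  with zw tensor_kernel_closed show "tensor_class \<alpha> M z = tensor_class \<alpha> M w"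
    unfolding tensor_class_altdef
    by (metis (no_types, lifting) image_subset_iff rev_image_eqI subset_antisym)
qed

lemma mem_tensor_class_iff: "w \<in> tensor_class \<alpha> M z \<longleftrightarrow> w - z \<in> tensor_kernel \<alpha> M"
  unfolding tensor_class_altdef by (auto intro: image_eqI[of _ _ "w - z"])

lemma carrier_tensor: "carrier (tensor \<alpha> M) = tensor_class \<alpha> M ` carrier (tensor_free M)"
  by (auto simp: tensor_def RCOSETS_def tensor_class_def)

lemma zero_tensor: "\<zero>\<^bsub>tensor \<alpha> M\<^esub> = tensor_class \<alpha> M 0"
  by (simp add: tensor_def tensor_class_altdef)

lemma add_tensor_class:
  "tensor_class \<alpha> M z \<oplus>\<^bsub>tensor \<alpha> M\<^esub> tensor_class \<alpha> M w = tensor_class \<alpha> M (z + w)"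
proof -
  have "{(k + z) + (l + w) |k l. k \<in> tensor_kernel \<alpha> M \<and> l \<in> tensor_kernel \<alpha> M} =
    {k + (z + w) |k. k \<in> tensor_kernel \<alpha> M}" (is "?L = ?R")
  proof (intro equalityI subsetI)
    fix u assume "u \<in> ?L"
    then obtain k l where "k \<in> tensor_kernel \<alpha> M" "l \<in> tensor_kernel \<alpha> M" "u = (k + l) + (z + w)"
      by (auto simp: ac_simps)
    then show "u \<in> ?R"
      using tensor_kernel_closed(2) by blast
  next
    fix u assume "u \<in> ?R"
    then obtain k where "k \<in> tensor_kernel \<alpha> M" "u = (k + z) + (0 + w)"
      by (auto simp: ac_simps)
    then show "u \<in> ?L"
      using tensor_kernel_closed(1) by blast
  qed
  then have "{u + u' |u u'. u \<in> tensor_class \<alpha> M z \<and> u' \<in> tensor_class \<alpha> M w} = tensor_class \<alpha> M (z + w)"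
    unfolding tensor_class_altdef by blast
  moreover have "U <#>\<^bsub>tensor_free M\<^esub> W = {u + u' |u u'. u \<in> U \<and> u' \<in> W}" for U W :: "('a \<times> 'c \<Rightarrow>\<^sub>0 int) set"
    by (auto simp: set_mult_def tensor_free_simps)
  ultimately show ?thesis
    by (simp add: tensor_def)
qed

text \<open>
  An operation given on generators descends to the tensor product as soon as it is biadditive and
  balanced modulo the relators.  Scalar multiplication and both one-sided multiplications are instances.
\<close>

lemma frag_extend_tensor_kernel:
  fixes f :: "'a \<times> 'c \<Rightarrow> 'a \<times> 'c \<Rightarrow>\<^sub>0 int"
  assumes closed: "\<And>a x. x \<in> carrier M \<Longrightarrow> f (a, x) \<in> carrier (tensor_free M)"
    and add_left: "\<And>a b x. x \<in> carrier M \<Longrightarrow> f (a + b, x) - f (a, x) - f (b, x) \<in> tensor_kernel \<alpha> M"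
    and add_right: "\<And>a x y. x \<in> carrier M \<Longrightarrow> y \<in> carrier M \<Longrightarrow>
      f (a, x \<oplus>\<^bsub>M\<^esub> y) - f (a, x) - f (a, y) \<in> tensor_kernel \<alpha> M"
    and balanced: "\<And>a c x. x \<in> carrier M \<Longrightarrow> f (a * \<alpha> c, x) - f (a, c \<odot>\<^bsub>M\<^esub> x) \<in> tensor_kernel \<alpha> M"
    and k: "k \<in> tensor_kernel \<alpha> M"
  shows "frag_extend f k \<in> tensor_kernel \<alpha> M"
proof -
  have "frag_extend f r \<in> tensor_kernel \<alpha> M" if "r \<in> tensor_relators \<alpha> M" for r
    using that unfolding tensor_relators_def
    by (elim UnE CollectE exE conjE) (simp_all add: frag_extend_diff add_left add_right balanced)
  then show ?thesis
    using tensor_kernel_hom_image[OF F.group_axioms frag_extend_hom_tensor_free[of f]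
        subgroup_tensor_kernel _ k] closed by blast
qed

lemma smult_tensor_class:
  "r \<odot>\<^bsub>tensor \<alpha> M\<^esub> tensor_class \<alpha> M z = tensor_class \<alpha> M (frag_extend (\<lambda>(a, x). frag_of (r * a, x)) z)"
proof -
  let ?m = "frag_extend (\<lambda>(a, x :: 'c). frag_of (r * a, x))"
  have "?m k \<in> tensor_kernel \<alpha> M" if "k \<in> tensor_kernel \<alpha> M" for k
    using that
    by (intro frag_extend_tensor_kernel)
      (simp_all add: tensor_free_simps distrib_left relators_in_tensor_kernel flip: mult.assoc)
  then have "tensor_class \<alpha> M (?m w) = tensor_class \<alpha> M (?m z)" if "w \<in> tensor_class \<alpha> M z" for w
    using that by (simp add: tensor_class_eq_iff mem_tensor_class_iff flip: frag_extend_diff)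
  moreover have "z \<in> tensor_class \<alpha> M z"
    by (simp add: mem_tensor_class_iff tensor_kernel_closed)
  ultimately have "(\<Union>w\<in>tensor_class \<alpha> M z. tensor_class \<alpha> M (?m w)) = tensor_class \<alpha> M (?m z)"
    by blast
  then show ?thesis
    by (simp add: tensor_def)
qed

lemma frag_extend_eq_on_tensor_free:
  assumes "z \<in> carrier (tensor_free M)" "\<And>a x. x \<in> carrier M \<Longrightarrow> f (a, x) = g (a, x)"
  shows "frag_extend f z = frag_extend g z"
  by (rule frag_extend_eq) (use assms in \<open>auto simp: carrier_tensor_free\<close>)

lemma abelian_group_tensor: "abelian_group (tensor \<alpha> M)"
proof (rule abelian_groupI)
  fix U assume "U \<in> carrier (tensor \<alpha> M)"
  then obtain z where "z \<in> carrier (tensor_free M)" "U = tensor_class \<alpha> M z"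
    by (auto simp: carrier_tensor)
  then have "tensor_class \<alpha> M (- z) \<in> carrier (tensor \<alpha> M)"
    "tensor_class \<alpha> M (- z) \<oplus>\<^bsub>tensor \<alpha> M\<^esub> U = \<zero>\<^bsub>tensor \<alpha> M\<^esub>"
    using F.inv_closed[of z] by (auto simp: carrier_tensor zero_tensor add_tensor_class tensor_free_simps)
  then show "\<exists>W\<in>carrier (tensor \<alpha> M). W \<oplus>\<^bsub>tensor \<alpha> M\<^esub> U = \<zero>\<^bsub>tensor \<alpha> M\<^esub>"
    by blast
next
  show "\<zero>\<^bsub>tensor \<alpha> M\<^esub> \<in> carrier (tensor \<alpha> M)"
    using F.one_closed by (auto simp: carrier_tensor zero_tensor tensor_free_simps)
next
  fix U W assume "U \<in> carrier (tensor \<alpha> M)" "W \<in> carrier (tensor \<alpha> M)"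
  then show "U \<oplus>\<^bsub>tensor \<alpha> M\<^esub> W \<in> carrier (tensor \<alpha> M)"
    by (auto simp: carrier_tensor add_tensor_class intro!: imageI tensor_free_add_closed)
qed (auto simp: carrier_tensor zero_tensor add_tensor_class algebra_simps)

lemma frag_induction_tensor_free [consumes 1, case_names zero frag diff]:
  assumes "z \<in> carrier (tensor_free M)"
    and "P 0" "\<And>a x. x \<in> carrier M \<Longrightarrow> P (frag_of (a, x))" "\<And>z w. P z \<Longrightarrow> P w \<Longrightarrow> P (z - w)"
  shows "P z"
proof -
  from assms(1) have "Poly_Mapping.keys z \<subseteq> UNIV \<times> carrier M"
    by (simp add: carrier_tensor_free)
  then show ?thesis
    by (induction rule: frag_induction) (use assms in auto)
qed

lemma module_tensor: "module ring_of_type_algebra (tensor \<alpha> M)"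
proof (rule module_ring_of_type_algebraI)
  let ?m = "\<lambda>r :: 'a. frag_extend (\<lambda>(a, x :: 'c). frag_of (r * a, x))"
  have hom: "?m r \<in> hom (tensor_free M) (tensor_free M)" for r :: 'a
    by (rule frag_extend_hom_tensor_free) (simp add: tensor_free_simps)
  show "abelian_group (tensor \<alpha> M)"
    by (rule abelian_group_tensor)
  show "r \<odot>\<^bsub>tensor \<alpha> M\<^esub> U \<in> carrier (tensor \<alpha> M)" if "U \<in> carrier (tensor \<alpha> M)" for r U
    using that hom_in_carrier[OF hom] by (auto simp: carrier_tensor smult_tensor_class)
  show "(r + s) \<odot>\<^bsub>tensor \<alpha> M\<^esub> U = r \<odot>\<^bsub>tensor \<alpha> M\<^esub> U \<oplus>\<^bsub>tensor \<alpha> M\<^esub> s \<odot>\<^bsub>tensor \<alpha> M\<^esub> U"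
    if "U \<in> carrier (tensor \<alpha> M)" for r s U
  proof -
    from that obtain z where z: "z \<in> carrier (tensor_free M)" and U: "U = tensor_class \<alpha> M z"
      by (auto simp: carrier_tensor)
    have "?m (r + s) z - (?m r z + ?m s z) \<in> tensor_kernel \<alpha> M"
      using z
    proof (induction rule: frag_induction_tensor_free)
      case (frag a x)
      then show ?case
        using relators_in_tensor_kernel(1)[of x "r * a" "s * a"] by (simp add: algebra_simps)
    next
      case (diff z w)
      have "?m (r + s) (z - w) - (?m r (z - w) + ?m s (z - w)) =
        (?m (r + s) z - (?m r z + ?m s z)) - (?m (r + s) w - (?m r w + ?m s w))"
        by (simp add: frag_extend_diff)
      with diff show ?case
        by (simp only: tensor_kernel_closed)
    qed (simp add: tensor_kernel_closed)
    then show ?thesis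
      by (simp add: U smult_tensor_class add_tensor_class tensor_class_eq_iff)
  qed
  show "r \<odot>\<^bsub>tensor \<alpha> M\<^esub> (U \<oplus>\<^bsub>tensor \<alpha> M\<^esub> W) = r \<odot>\<^bsub>tensor \<alpha> M\<^esub> U \<oplus>\<^bsub>tensor \<alpha> M\<^esub> r \<odot>\<^bsub>tensor \<alpha> M\<^esub> W"
    if "U \<in> carrier (tensor \<alpha> M)" "W \<in> carrier (tensor \<alpha> M)" for r U W
    using that by (auto simp: carrier_tensor smult_tensor_class add_tensor_class frag_extend_add)
  show "(r * s) \<odot>\<^bsub>tensor \<alpha> M\<^esub> U = r \<odot>\<^bsub>tensor \<alpha> M\<^esub> (s \<odot>\<^bsub>tensor \<alpha> M\<^esub> U)"
    if "U \<in> carrier (tensor \<alpha> M)" for r s U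
  proof -
    from that obtain z where z: "z \<in> carrier (tensor_free M)" and U: "U = tensor_class \<alpha> M z"
      by (auto simp: carrier_tensor)
    have "?m (r * s) z = ?m r (?m s z)"
      using z by (induction rule: frag_induction_tensor_free) (simp_all add: frag_extend_diff mult.assoc)
    then show ?thesis
      by (simp add: U smult_tensor_class)
  qed
  show "1 \<odot>\<^bsub>tensor \<alpha> M\<^esub> U = U" if "U \<in> carrier (tensor \<alpha> M)" for U
  proof -
    have frag_of: "(\<lambda>(a :: 'a, x :: 'c). frag_of (1 * a, x)) = frag_of"
      by auto
    have "?m 1 z = z" for z
      unfolding frag_of by (rule frag_expansion[symmetric])
    then show ?thesis
      using that by (auto simp: carrier_tensor smult_tensor_class)
  qed
qed

lemma pure_tensor_closed: "x \<in> carrier M \<Longrightarrow> pure_tensor \<alpha> M a x \<in> carrier (tensor \<alpha> M)"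
  by (auto simp: pure_tensor_def carrier_tensor tensor_free_simps)

lemma smult_pure_tensor: "r \<odot>\<^bsub>tensor \<alpha> M\<^esub> pure_tensor \<alpha> M a x = pure_tensor \<alpha> M (r * a) x"
  by (simp add: pure_tensor_def smult_tensor_class)

lemma pure_tensor_add_right:
  assumes "x \<in> carrier M" "y \<in> carrier M"
  shows "pure_tensor \<alpha> M a (x \<oplus>\<^bsub>M\<^esub> y) = pure_tensor \<alpha> M a x \<oplus>\<^bsub>tensor \<alpha> M\<^esub> pure_tensor \<alpha> M a y"
  using relators_in_tensor_kernel(2)[OF assms]
  by (simp add: pure_tensor_def add_tensor_class tensor_class_eq_iff diff_diff_add)

lemma pure_tensor_smult_right:
  "x \<in> carrier M \<Longrightarrow> pure_tensor \<alpha> M a (c \<odot>\<^bsub>M\<^esub> x) = pure_tensor \<alpha> M (a * \<alpha> c) x"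
  by (rule sym) (simp add: pure_tensor_def tensor_class_eq_iff relators_in_tensor_kernel(3))

text \<open>
  The product of representatives is biadditive, so independence of the representatives reduces to
  multiplying the kernel by a single generator from the left and from the right.  There balancedness
  needs scalars of \<open>M\<close> to move out of either factor of a product.
\<close>

lemma mult_tensor_class:
  assumes "ring M"
    and smult_mult: "\<And>c x y. x \<in> carrier M \<Longrightarrow> y \<in> carrier M \<Longrightarrow> (c \<odot>\<^bsub>M\<^esub> x) \<otimes>\<^bsub>M\<^esub> y = c \<odot>\<^bsub>M\<^esub> (x \<otimes>\<^bsub>M\<^esub> y)"
    and mult_smult: "\<And>c x y. x \<in> carrier M \<Longrightarrow> y \<in> carrier M \<Longrightarrow> x \<otimes>\<^bsub>M\<^esub> (c \<odot>\<^bsub>M\<^esub> y) = c \<odot>\<^bsub>M\<^esub> (x \<otimes>\<^bsub>M\<^esub> y)"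
    and z: "z \<in> carrier (tensor_free M)" and w: "w \<in> carrier (tensor_free M)"
  shows "tensor_class \<alpha> M z \<otimes>\<^bsub>tensor \<alpha> M\<^esub> tensor_class \<alpha> M w =
    tensor_class \<alpha> M (frag_extend (\<lambda>(a, x). frag_extend (\<lambda>(b, y). frag_of (a * b, x \<otimes>\<^bsub>M\<^esub> y)) w) z)"
proof -
  interpret R: ring M
    by fact
  define m :: "('a \<times> 'c \<Rightarrow>\<^sub>0 int) \<Rightarrow> ('a \<times> 'c \<Rightarrow>\<^sub>0 int) \<Rightarrow> 'a \<times> 'c \<Rightarrow>\<^sub>0 int"
    where "m z w = frag_extend (\<lambda>(a, x). frag_extend (\<lambda>(b, y). frag_of (a * b, x \<otimes>\<^bsub>M\<^esub> y)) w) z" for z w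
  have m_diff_left: "m (z - z') w = m z w - m z' w" for z z' w
    by (simp add: m_def frag_extend_diff)
  have m_diff_right: "m z (w - w') = m z w - m z w'" for z w w'
  proof -
    have "Poly_Mapping.keys z \<subseteq> UNIV"
      by simp
    then show ?thesis
      by (induction rule: frag_induction) (auto simp: m_def frag_extend_diff)
  qed
  have m_0: "m z 0 = 0" "m 0 w = 0" for z w
    using m_diff_right[of z 0 0] m_diff_left[of 0 0 w] by simp_all
  have kernel_left: "m k w \<in> tensor_kernel \<alpha> M"
    if k: "k \<in> tensor_kernel \<alpha> M" and w: "w \<in> carrier (tensor_free M)" for k w
    using w
  proof (induction rule: frag_induction_tensor_free)
    case (frag b y)
    with k show ?case
      unfolding m_def frag_extend_of case_prod_conv
      by (intro frag_extend_tensor_kernel)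
        (simp_all add: tensor_free_simps distrib_left R.l_distr smult_mult relators_in_tensor_kernel
          mult.commute[of _ b] flip: mult.assoc)
  qed (simp_all add: m_0 m_diff_right tensor_kernel_closed)
  have kernel_right: "m z k \<in> tensor_kernel \<alpha> M"
    if k: "k \<in> tensor_kernel \<alpha> M" and z: "z \<in> carrier (tensor_free M)" for k z
    using z
  proof (induction rule: frag_induction_tensor_free)
    case (frag a x)
    with k show ?case
      unfolding m_def frag_extend_of case_prod_conv
      by (intro frag_extend_tensor_kernel)
        (simp_all add: tensor_free_simps distrib_left R.r_distr mult_smult relators_in_tensor_kernel
          flip: mult.assoc)
  qed (simp_all add: m_0 m_diff_left tensor_kernel_closed)
  have "tensor_class \<alpha> M (m z' w') = tensor_class \<alpha> M (m z w)"
    if "z' \<in> tensor_class \<alpha> M z" "w' \<in> tensor_class \<alpha> M w" for z' w'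
  proof -
    have k: "z' - z \<in> tensor_kernel \<alpha> M" "w' - w \<in> tensor_kernel \<alpha> M"
      using that by (simp_all add: mem_tensor_class_iff)
    have "w' \<in> carrier (tensor_free M)"
      using tensor_free_add_closed[OF K.mem_carrier[OF k(2)] w] by simp
    then have "m (z' - z) w' + m z (w' - w) \<in> tensor_kernel \<alpha> M"
      using k z by (intro tensor_kernel_closed(2) kernel_left kernel_right)
    then show ?thesis
      by (simp add: tensor_class_eq_iff m_diff_left m_diff_right)
  qed
  moreover have "z \<in> tensor_class \<alpha> M z" "w \<in> tensor_class \<alpha> M w"
    by (simp_all add: mem_tensor_class_iff tensor_kernel_closed)
  ultimately have "(\<Union>z'\<in>tensor_class \<alpha> M z. \<Union>w'\<in>tensor_class \<alpha> M w. tensor_class \<alpha> M (m z' w')) =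
    tensor_class \<alpha> M (m z w)"
    by blast
  then show ?thesis
    by (simp add: tensor_def m_def)
qed

lemma scalar_mult_tensor:
  assumes "ring M"
    and "\<And>c x y. x \<in> carrier M \<Longrightarrow> y \<in> carrier M \<Longrightarrow> (c \<odot>\<^bsub>M\<^esub> x) \<otimes>\<^bsub>M\<^esub> y = c \<odot>\<^bsub>M\<^esub> (x \<otimes>\<^bsub>M\<^esub> y)"
    and "\<And>c x y. x \<in> carrier M \<Longrightarrow> y \<in> carrier M \<Longrightarrow> x \<otimes>\<^bsub>M\<^esub> (c \<odot>\<^bsub>M\<^esub> y) = c \<odot>\<^bsub>M\<^esub> (x \<otimes>\<^bsub>M\<^esub> y)"
    and "U \<in> carrier (tensor \<alpha> M)"
  shows "(r \<odot>\<^bsub>tensor \<alpha> M\<^esub> \<one>\<^bsub>tensor \<alpha> M\<^esub>) \<otimes>\<^bsub>tensor \<alpha> M\<^esub> U = r \<odot>\<^bsub>tensor \<alpha> M\<^esub> U"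
proof -
  interpret R: ring M
    by fact
  obtain z where z: "z \<in> carrier (tensor_free M)" and U: "U = tensor_class \<alpha> M z"
    using assms(4) by (auto simp: carrier_tensor)
  have "r \<odot>\<^bsub>tensor \<alpha> M\<^esub> \<one>\<^bsub>tensor \<alpha> M\<^esub> = tensor_class \<alpha> M (frag_of (r, \<one>\<^bsub>M\<^esub>))"
    using smult_pure_tensor[of r 1 "\<one>\<^bsub>M\<^esub>"] by (simp add: tensor_def pure_tensor_def)
  moreover have "tensor_class \<alpha> M (frag_of (r, \<one>\<^bsub>M\<^esub>)) \<otimes>\<^bsub>tensor \<alpha> M\<^esub> U =
    tensor_class \<alpha> M (frag_extend (\<lambda>(b, y). frag_of (r * b, \<one>\<^bsub>M\<^esub> \<otimes>\<^bsub>M\<^esub> y)) z)"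
    unfolding U by (subst mult_tensor_class) (use assms z in \<open>simp_all add: tensor_free_simps\<close>)
  moreover have "frag_extend (\<lambda>(b, y). frag_of (r * b, \<one>\<^bsub>M\<^esub> \<otimes>\<^bsub>M\<^esub> y)) z =
    frag_extend (\<lambda>(b, y). frag_of (r * b, y)) z"
    using z by (rule frag_extend_eq_on_tensor_free) simp
  ultimately show ?thesis
    by (simp add: U smult_tensor_class)
qed

end

section \<open>Specialization as a quotient\<close>

lemma const_simps:
  "const (1 :: 'a::comm_ring_1) = 1" "const (- a :: 'a) = - const a" "const (a * b :: 'a) = const a * const b"
  "const (a + b :: 'a) = const a + const b"
  by (simp_all add: const_def one_pi_ext_def uminus_pi_ext_def times_pi_ext_def plus_pi_ext_def)

lemma eval_pi_simps [simp]:
  "eval_pi s (const a) = a" "eval_pi s (pi_elem - const s) = 0"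
  by (simp_all add: eval_pi_def const_def pi_elem_def minus_pi_ext_def)

text \<open>
  Evaluation at \<open>\<pi> = s\<close> changes a scalar only by a multiple of \<open>\<pi> - s\<close>.  This identity makes the
  balancing relators vanish modulo \<open>(\<pi> - s) M\<close>.
\<close>

lemma const_eval_pi_minus: "const (eval_pi s c) - c = (pi_elem - const s) * const (- pi_snd c)"
  by (cases c) (simp add: eval_pi_def const_def pi_elem_def minus_pi_ext_def times_pi_ext_def)

context
  fixes s :: "'a::comm_ring_1" and M :: "('a pi_ext, 'c) module"
  assumes M: "module ring_of_type_algebra M"
begin

interpretation M: module ring_of_type_algebra M
  by (fact M)

interpretation S: module ring_of_type_algebra "specialization s M"
  unfolding specialization_def by (rule module_tensor[OF M])

lemma specialization_map_hom:
  "pure_tensor (eval_pi s) M 1 \<in> hom (add_monoid M) (add_monoid (specialization s M))"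
  by (rule homI) (simp_all add: specialization_def pure_tensor_closed[OF M] pure_tensor_add_right[OF M])

lemma specialization_map_smult:
  assumes "x \<in> carrier M"
  shows "pure_tensor (eval_pi s) M 1 (c \<odot>\<^bsub>M\<^esub> x) =
    eval_pi s c \<odot>\<^bsub>specialization s M\<^esub> pure_tensor (eval_pi s) M 1 x"
  using assms by (simp add: specialization_def pure_tensor_smult_right[OF M] smult_pure_tensor[OF M])

interpretation q: group_hom "add_monoid M" "add_monoid (specialization s M)" "pure_tensor (eval_pi s) M 1"
  using M.a_group S.a_group specialization_map_hom by (simp add: group_hom_def group_hom_axioms_def)

text \<open>
  The scalars \<open>a\<close> of the specialized ring lift to \<open>const a\<close>, so that \<open>a \<otimes> x = 1 \<otimes> const a x\<close>.
\<close>

lemma specialization_map_surj: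
  "pure_tensor (eval_pi s) M 1 ` carrier M = carrier (specialization s M)"
proof (intro equalityI subsetI)
  fix U assume "U \<in> carrier (specialization s M)"
  then obtain z where z: "z \<in> carrier (tensor_free M)" and U: "U = tensor_class (eval_pi s) M z"
    by (auto simp: specialization_def carrier_tensor[OF M])
  have "\<exists>x\<in>carrier M. z - frag_of (1, x) \<in> tensor_kernel (eval_pi s) M"
    using z
  proof (induction rule: frag_induction_tensor_free[OF M, consumes 1, case_names zero frag diff])
    case zero
    have "0 - frag_of (1, \<zero>\<^bsub>M\<^esub>) \<in> tensor_kernel (eval_pi s) M"
      using relators_in_tensor_kernel(2)[OF M, of "\<zero>\<^bsub>M\<^esub>" "\<zero>\<^bsub>M\<^esub>" 1] by simp
    then show ?case
      by blast
  next
    case (frag a x)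
    then have "const a \<odot>\<^bsub>M\<^esub> x \<in> carrier M"
      "frag_of (a, x) - frag_of (1, const a \<odot>\<^bsub>M\<^esub> x) \<in> tensor_kernel (eval_pi s) M"
      using relators_in_tensor_kernel(3)[OF M, of x 1 "eval_pi s" "const a"] by simp_all
    then show ?case
      by blast
  next
    case (diff z w)
    then obtain x y where xy: "x \<in> carrier M" "y \<in> carrier M"
      and zw: "z - frag_of (1, x) \<in> tensor_kernel (eval_pi s) M" "w - frag_of (1, y) \<in> tensor_kernel (eval_pi s) M"
      by blast
    have "(x \<ominus>\<^bsub>M\<^esub> y) \<oplus>\<^bsub>M\<^esub> y = x"
      using xy by (simp add: a_minus_def M.a_assoc M.l_neg)
    then have "frag_of (1, x) - frag_of (1, x \<ominus>\<^bsub>M\<^esub> y) - frag_of (1, y) \<in> tensor_kernel (eval_pi s) M"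
      using relators_in_tensor_kernel(2)[OF M, of "x \<ominus>\<^bsub>M\<^esub> y" y 1 "eval_pi s"] xy by simp
    then have "(z - frag_of (1, x)) - (w - frag_of (1, y)) +
      (frag_of (1, x) - frag_of (1, x \<ominus>\<^bsub>M\<^esub> y) - frag_of (1, y)) \<in> tensor_kernel (eval_pi s) M"
      by (rule tensor_kernel_closed(2)[OF M tensor_kernel_closed(4)[OF M zw]])
    then have "(z - w) - frag_of (1, x \<ominus>\<^bsub>M\<^esub> y) \<in> tensor_kernel (eval_pi s) M"
      by (simp add: algebra_simps)
    then show ?case
      using xy by blast
  qed
  then show "U \<in> pure_tensor (eval_pi s) M 1 ` carrier M"
    unfolding U pure_tensor_def by (auto simp: tensor_class_eq_iff[OF M])
qed (use q.hom_closed in auto)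

text \<open>
  That \<open>(\<pi> - s) y\<close> dies is clear.  Conversely, \<open>a \<otimes> x \<mapsto> const a x\<close> defines a homomorphism from the
  free group to \<open>M\<close> that sends every relator into \<open>(\<pi> - s) M\<close> and \<open>1 \<otimes> x\<close> to \<open>x\<close>.
\<close>

lemma specialization_map_eq_zero_iff:
  assumes "x \<in> carrier M"
  shows "pure_tensor (eval_pi s) M 1 x = \<zero>\<^bsub>specialization s M\<^esub> \<longleftrightarrow>
    (\<exists>y\<in>carrier M. x = (pi_elem - const s) \<odot>\<^bsub>M\<^esub> y)"
proof
  assume "\<exists>y\<in>carrier M. x = (pi_elem - const s) \<odot>\<^bsub>M\<^esub> y"
  then obtain y where "y \<in> carrier M" "x = (pi_elem - const s) \<odot>\<^bsub>M\<^esub> y"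
    by blast
  then show "pure_tensor (eval_pi s) M 1 x = \<zero>\<^bsub>specialization s M\<^esub>"
    using q.hom_closed[of y] S.smult_l_null by (simp add: specialization_map_smult)
next
  define L where "L = {(pi_elem - const s) \<odot>\<^bsub>M\<^esub> y |y. y \<in> carrier M}"
  have smult_diff: "(a - b) \<odot>\<^bsub>M\<^esub> y = a \<odot>\<^bsub>M\<^esub> y \<ominus>\<^bsub>M\<^esub> b \<odot>\<^bsub>M\<^esub> y" if "y \<in> carrier M" for a b y
  proof -
    have "a \<odot>\<^bsub>M\<^esub> y = (a - b) \<odot>\<^bsub>M\<^esub> y \<oplus>\<^bsub>M\<^esub> b \<odot>\<^bsub>M\<^esub> y"
      using M.smult_l_distr[of "a - b" b y] that by simp
    then show ?thesis
      using that by (simp add: a_minus_def M.a_assoc M.r_neg)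
  qed
  have L: "subgroup L (add_monoid M)"
  proof (rule M.add.subgroupI)
    show "L \<subseteq> carrier M" "L \<noteq> {}"
      by (auto simp: L_def)
    show "\<ominus>\<^bsub>M\<^esub> u \<in> L" if "u \<in> L" for u
      using that M.smult_r_minus unfolding L_def by (force simp flip: M.smult_r_minus)
    show "u \<oplus>\<^bsub>M\<^esub> u' \<in> L" if "u \<in> L" "u' \<in> L" for u u'
      using that unfolding L_def by (force simp flip: M.smult_r_distr)
  qed
  have "(\<lambda>(a, y). const a \<odot>\<^bsub>M\<^esub> y) ` (UNIV \<times> carrier M) \<subseteq> carrier (add_monoid M)"
    by auto
  then obtain g where g: "g \<in> hom (tensor_free M) (add_monoid M)"
    and g_frag_of: "\<And>a y. y \<in> carrier M \<Longrightarrow> g (frag_of (a, y)) = const a \<odot>\<^bsub>M\<^esub> y"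
    using comm_group.free_Abelian_group_universal[OF M.a_comm_group,
        of "\<lambda>(a, y). const a \<odot>\<^bsub>M\<^esub> y" "UNIV \<times> carrier M"]
    unfolding tensor_free_def by (metis (no_types, lifting) UNIV_I case_prod_conv mem_Sigma_iff)
  interpret g: group_hom "tensor_free M" "add_monoid M" g
    using g M.a_group by (simp add: group_hom_def group_hom_axioms_def tensor_free_def)
  have g_diff: "g (z - w) = g z \<ominus>\<^bsub>M\<^esub> g w" if "z \<in> carrier (tensor_free M)" "w \<in> carrier (tensor_free M)" for z w
  proof -
    have "- w \<in> carrier (tensor_free M)"
      using that(2) by (simp add: carrier_tensor_free[OF M])
    then show ?thesis
      using that g.hom_mult[of z "- w"] g.hom_inv[of w]
      by (simp add: tensor_free_simps[OF M] a_minus_def a_inv_def)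
  qed
  assume "pure_tensor (eval_pi s) M 1 x = \<zero>\<^bsub>specialization s M\<^esub>"
  then have "frag_of (1, x) \<in> tensor_kernel (eval_pi s) M"
    by (simp add: specialization_def pure_tensor_def zero_tensor[OF M] tensor_class_eq_iff[OF M])
  then have "g (frag_of (1, x)) \<in> L"
  proof (rule tensor_kernel_hom_image[OF M M.a_group g L, rotated])
    fix r assume "r \<in> tensor_relators (eval_pi s) M"
    then show "g r \<in> L"
      unfolding tensor_relators_def
    proof (elim UnE CollectE exE conjE)
      fix a b y assume "r = frag_of (a + b, y) - frag_of (a, y) - frag_of (b, y)" "y \<in> carrier M"
      then have "g r = (const (a + b) - const a - const b) \<odot>\<^bsub>M\<^esub> y"
        by (simp add: g_diff g_frag_of smult_diff tensor_free_simps[OF M] tensor_free_diff_closed[OF M])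
      also have "\<dots> = (pi_elem - const s) \<odot>\<^bsub>M\<^esub> \<zero>\<^bsub>M\<^esub>"
        using \<open>y \<in> carrier M\<close> M.smult_l_null M.smult_r_null by (simp add: const_simps)
      finally show ?thesis
        unfolding L_def by blast
    next
      fix a y y' assume r: "r = frag_of (a, y \<oplus>\<^bsub>M\<^esub> y') - frag_of (a, y) - frag_of (a, y')"
        and y: "y \<in> carrier M" "y' \<in> carrier M"
      have "g r = \<zero>\<^bsub>M\<^esub>"
        using y unfolding r
        by (simp add: g_diff g_frag_of tensor_free_simps[OF M] tensor_free_diff_closed[OF M]
            M.smult_r_distr a_minus_def M.a_ac M.r_neg M.r_neg2 M.minus_add)
      then show ?thesis
        using subgroup.one_closed[OF L] by simp
    next
      fix a c y assume r: "r = frag_of (a * eval_pi s c, y) - frag_of (a, c \<odot>\<^bsub>M\<^esub> y)" and y: "y \<in> carrier M"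
      have "g r = (const (a * eval_pi s c) - const a * c) \<odot>\<^bsub>M\<^esub> y"
        using y M.smult_assoc1[of "const a" c y] unfolding r
        by (simp add: g_diff g_frag_of smult_diff tensor_free_simps[OF M])
      also have "const (a * eval_pi s c) - const a * c = const a * (const (eval_pi s c) - c)"
        by (simp add: const_simps algebra_simps)
      also have "\<dots> = (pi_elem - const s) * (const a * const (- pi_snd c))"
        by (simp add: const_eval_pi_minus mult.left_commute)
      also have "\<dots> \<odot>\<^bsub>M\<^esub> y = (pi_elem - const s) \<odot>\<^bsub>M\<^esub> ((const a * const (- pi_snd c)) \<odot>\<^bsub>M\<^esub> y)"
        using y M.smult_assoc1 by simp
      finally show ?thesis
        using y unfolding L_def by auto
    qed
  qed
  then show "\<exists>y\<in>carrier M. x = (pi_elem - const s) \<odot>\<^bsub>M\<^esub> y"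
    using assms M.smult_one by (auto simp: g_frag_of const_simps L_def)
qed

end

section \<open>Descent to the specializations\<close>

text \<open>
  \<open>H\<close> and \<open>H'\<close> are the quotients of \<open>G\<close> and \<open>G'\<close> by normal subgroups that \<open>F\<close> identifies.
\<close>

lemma iso_of_surjective_homs:
  assumes "group G" "group G'" "group H" "group H'"
    and p: "p \<in> hom G H" "p ` carrier G = carrier H"
    and p': "p' \<in> hom G' H'" "p' ` carrier G' = carrier H'"
    and F: "F \<in> iso G G'"
    and kernel: "\<And>x. x \<in> carrier G \<Longrightarrow> p x = \<one>\<^bsub>H\<^esub> \<longleftrightarrow> p' (F x) = \<one>\<^bsub>H'\<^esub>"
  shows "\<exists>h\<in>iso H H'. \<forall>x\<in>carrier G. h (p x) = p' (F x)"
proof -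
  interpret p: group_hom G H p
    using assms by (simp add: group_hom_def group_hom_axioms_def)
  interpret p': group_hom G' H' p'
    using assms by (simp add: group_hom_def group_hom_axioms_def)
  interpret F: group_hom G G' F
    using assms by (simp add: group_hom_def group_hom_axioms_def iso_def)
  have F_surj: "F ` carrier G = carrier G'"
    using F by (simp add: iso_iff)
  have eq_iff: "p x = p y \<longleftrightarrow> p' (F x) = p' (F y)" if "x \<in> carrier G" "y \<in> carrier G" for x y
  proof -
    have "p x = p y \<longleftrightarrow> p (x \<otimes>\<^bsub>G\<^esub> inv\<^bsub>G\<^esub> y) = \<one>\<^bsub>H\<^esub>"
      using that by (simp add: p.inv_solve_right')
    also have "\<dots> \<longleftrightarrow> p' (F (x \<otimes>\<^bsub>G\<^esub> inv\<^bsub>G\<^esub> y)) = \<one>\<^bsub>H'\<^esub>"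
      using that by (intro kernel) simp
    also have "\<dots> \<longleftrightarrow> p' (F x) = p' (F y)"
      using that by (simp add: p'.inv_solve_right')
    finally show ?thesis .
  qed
  define h where "h U = p' (F (SOME x. x \<in> carrier G \<and> p x = U))" for U
  have h_p: "h (p x) = p' (F x)" if "x \<in> carrier G" for x
  proof -
    have "\<exists>y. y \<in> carrier G \<and> p y = p x"
      using that by blast
    then have "(SOME y. y \<in> carrier G \<and> p y = p x) \<in> carrier G \<and> p (SOME y. y \<in> carrier G \<and> p y = p x) = p x"
      by (rule someI_ex)
    then show ?thesis
      unfolding h_def using eq_iff that by blast
  qed
  have "h \<in> hom H H'"
  proof (rule homI)
    fix U W assume "U \<in> carrier H" "W \<in> carrier H"
    then obtain x y where "x \<in> carrier G" "y \<in> carrier G" "U = p x" "W = p y"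
      using p(2) by blast
    then show "h U \<in> carrier H'" "h (U \<otimes>\<^bsub>H\<^esub> W) = h U \<otimes>\<^bsub>H'\<^esub> h W"
      by (simp_all add: h_p flip: p.hom_mult)
  qed
  moreover have "h ` carrier H = carrier H'"
    unfolding p(2)[symmetric] p'(2)[symmetric] F_surj[symmetric] image_image by (simp add: h_p)
  moreover have "inj_on h (carrier H)"
    unfolding p(2)[symmetric] by (auto simp: inj_on_def h_p eq_iff)
  ultimately have "h \<in> iso H H'"
    by (simp add: iso_iff)
  then show ?thesis
    using h_p by blast
qed

text \<open>
  Since \<open>F ((\<pi> - 1) x) = - \<pi> F x - F x = (\<pi> - (- 1)) F (- x)\<close>, the kernel of the specialization at
  \<open>1\<close> is matched with the kernel of the specialization at \<open>- 1\<close>.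
\<close>

lemma specialization_iso_of_pi_antilinear:
  fixes M :: "('a::comm_ring_1 pi_ext, 'c) module" and N :: "('a pi_ext, 'd) module"
  assumes M: "module ring_of_type_algebra M" and N: "module ring_of_type_algebra N"
    and F: "F \<in> iso (add_monoid M) (add_monoid N)"
    and F_pi: "\<And>x. x \<in> carrier M \<Longrightarrow> F (pi_elem \<odot>\<^bsub>M\<^esub> x) = (- pi_elem) \<odot>\<^bsub>N\<^esub> F x"
  shows "\<exists>h\<in>iso (add_monoid (specialization 1 M)) (add_monoid (specialization (- 1) N)).
    \<forall>x\<in>carrier M. h (pure_tensor (eval_pi 1) M 1 x) = pure_tensor (eval_pi (- 1)) N 1 (F x)"
proof -
  interpret M: module ring_of_type_algebra M
    by (fact M)
  interpret N: module ring_of_type_algebra N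
    by (fact N)
  interpret SM: module ring_of_type_algebra "specialization 1 M"
    unfolding specialization_def by (rule module_tensor[OF M])
  interpret SN: module ring_of_type_algebra "specialization (- 1) N"
    unfolding specialization_def by (rule module_tensor[OF N])
  have F_closed: "F x \<in> carrier N" if "x \<in> carrier M" for x
    using F that by (auto simp: iso_def hom_def)
  have F_add: "F (x \<oplus>\<^bsub>M\<^esub> y) = F x \<oplus>\<^bsub>N\<^esub> F y" if "x \<in> carrier M" "y \<in> carrier M" for x y
    using F that by (auto simp: iso_def hom_def)
  have F_minus: "F (\<ominus>\<^bsub>M\<^esub> x) = \<ominus>\<^bsub>N\<^esub> F x" if "x \<in> carrier M" for x
    using F group_hom.hom_inv[of "add_monoid M" "add_monoid N" F x] M.a_group N.a_group that
    by (simp add: group_hom_def group_hom_axioms_def iso_def a_inv_def)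
  have F_surj: "\<exists>x\<in>carrier M. y = F x" if "y \<in> carrier N" for y
  proof -
    have "F ` carrier M = carrier N"
      using F by (simp add: iso_iff)
    with that have "y \<in> F ` carrier M"
      by simp
    then show ?thesis
      unfolding image_def mem_Collect_eq .
  qed
  have "inj_on F (carrier M)"
    using F by (simp add: iso_iff)
  then have F_inj: "x = y" if "F x = F y" "x \<in> carrier M" "y \<in> carrier M" for x y
    using that by (rule inj_onD)
  have neg_one: "(- 1) \<odot>\<^bsub>M\<^esub> x = \<ominus>\<^bsub>M\<^esub> x" if "x \<in> carrier M" for x
    using that M.smult_l_distr[of "- 1" 1 x] M.smult_l_null[of x] M.smult_one[of x]
    by (simp add: M.minus_equality)
  have neg_one': "(- 1) \<odot>\<^bsub>N\<^esub> y = \<ominus>\<^bsub>N\<^esub> y" if "y \<in> carrier N" for y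
    using that N.smult_l_distr[of "- 1" 1 y] N.smult_l_null[of y] N.smult_one[of y]
    by (simp add: N.minus_equality)
  have F_pi_minus_1: "F ((pi_elem - const 1) \<odot>\<^bsub>M\<^esub> x) = (pi_elem - const (- 1)) \<odot>\<^bsub>N\<^esub> F (\<ominus>\<^bsub>M\<^esub> x)"
    if x: "x \<in> carrier M" for x
  proof -
    have "F ((pi_elem - const 1) \<odot>\<^bsub>M\<^esub> x) = F (pi_elem \<odot>\<^bsub>M\<^esub> x \<oplus>\<^bsub>M\<^esub> (- 1) \<odot>\<^bsub>M\<^esub> x)"
      using x M.smult_l_distr[of pi_elem "- 1" x] by (simp add: const_simps)
    also have "\<dots> = (- pi_elem) \<odot>\<^bsub>N\<^esub> F x \<oplus>\<^bsub>N\<^esub> (- 1) \<odot>\<^bsub>N\<^esub> F x"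
      using x M.smult_closed by (simp add: neg_one neg_one' F_add F_minus F_pi F_closed)
    also have "\<dots> = (pi_elem - const (- 1)) \<odot>\<^bsub>N\<^esub> ((- 1) \<odot>\<^bsub>N\<^esub> F x)"
      using x F_closed[of x] N.smult_l_distr[of "- pi_elem" "- 1" "F x"]
        N.smult_assoc1[of "pi_elem - const (- 1)" "- 1" "F x"] by (simp add: const_simps)
    finally show ?thesis
      using x by (simp add: neg_one' F_minus F_closed)
  qed
  have kernel: "pure_tensor (eval_pi 1) M 1 x = \<zero>\<^bsub>specialization 1 M\<^esub> \<longleftrightarrow>
      pure_tensor (eval_pi (- 1)) N 1 (F x) = \<zero>\<^bsub>specialization (- 1) N\<^esub>" if x: "x \<in> carrier M" for x
  proof -
    have "pure_tensor (eval_pi 1) M 1 x = \<zero>\<^bsub>specialization 1 M\<^esub> \<longleftrightarrow>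
      (\<exists>y\<in>carrier M. x = (pi_elem - const 1) \<odot>\<^bsub>M\<^esub> y)"
      by (rule specialization_map_eq_zero_iff[OF M x])
    also have "\<dots> \<longleftrightarrow> (\<exists>y\<in>carrier M. F x = F ((pi_elem - const 1) \<odot>\<^bsub>M\<^esub> y))"
      by (intro bex_cong refl iffI, simp, rule F_inj) (use x M.smult_closed in simp_all)
    also have "\<dots> \<longleftrightarrow> (\<exists>y\<in>carrier M. F x = (pi_elem - const (- 1)) \<odot>\<^bsub>N\<^esub> F (\<ominus>\<^bsub>M\<^esub> y))"
      by (simp add: F_pi_minus_1)
    also have "\<dots> \<longleftrightarrow> (\<exists>y\<in>carrier N. F x = (pi_elem - const (- 1)) \<odot>\<^bsub>N\<^esub> y)"
    proof -
      have "\<exists>z\<in>carrier M. F (\<ominus>\<^bsub>M\<^esub> z) = y" if y: "y \<in> carrier N" for y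
      proof -
        obtain z where "z \<in> carrier M" "y = F z"
          using F_surj[OF y] by blast
        then show ?thesis
          by (intro bexI[of _ "\<ominus>\<^bsub>M\<^esub> z"]) simp_all
      qed
      then show ?thesis
        using F_closed[OF M.a_inv_closed] by blast
    qed
    also have "\<dots> \<longleftrightarrow> pure_tensor (eval_pi (- 1)) N 1 (F x) = \<zero>\<^bsub>specialization (- 1) N\<^esub>"
      by (rule specialization_map_eq_zero_iff[OF N F_closed[OF x], symmetric])
    finally show ?thesis .
  qed
  have "pure_tensor (eval_pi 1) M 1 ` carrier (add_monoid M) = carrier (add_monoid (specialization 1 M))"
    "pure_tensor (eval_pi (- 1)) N 1 ` carrier (add_monoid N) = carrier (add_monoid (specialization (- 1) N))"
    by (simp_all add: specialization_map_surj[OF M] specialization_map_surj[OF N])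
  with iso_of_surjective_homs[OF M.a_group N.a_group SM.a_group SN.a_group
      specialization_map_hom[OF M] _ specialization_map_hom[OF N] _ F] kernel
  show ?thesis
    by simp
qed

section \<open>The half covering quantum group is an algebra\<close>

context super_cartan_datum
begin

interpretation A: ring "ring_of_type_algebra :: ('i free_monoid \<Rightarrow>\<^sub>0 Qv pi_ext) ring"
  by (rule ring_ring_of_type_algebra)

interpretation J: ideal serre_ideal "ring_of_type_algebra :: ('i free_monoid \<Rightarrow>\<^sub>0 Qv pi_ext) ring"
  unfolding serre_ideal_def by (rule A.genideal_ideal) simp

lemma carrier_f: "carrier \<f> = range f_class"
  by (auto simp: \<f>_def ring.defs module.defs FactRing_def A_RCOSETS_def RCOSETS_def f_class_def a_r_coset_def
      ring_of_type_algebra_def)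

lemma add_f_class: "f_class x \<oplus>\<^bsub>\<f>\<^esub> f_class y = f_class (x + y)"
  using J.a_rcos_sum[of x y] by (simp add: \<f>_def ring.defs module.defs FactRing_def f_class_def)

lemma mult_f_class: "f_class x \<otimes>\<^bsub>\<f>\<^esub> f_class y = f_class (x * y)"
  using J.rcoset_mult_add[of x y] by (simp add: \<f>_def ring.defs module.defs FactRing_def f_class_def)

lemma zero_f: "\<zero>\<^bsub>\<f>\<^esub> = f_class 0"
  using A.a_coset_add_zero[of serre_ideal]
  by (simp add: \<f>_def ring.defs module.defs FactRing_def f_class_def)

lemma one_f: "\<one>\<^bsub>\<f>\<^esub> = f_class 1"
  by (simp add: \<f>_def ring.defs module.defs FactRing_def f_class_def)

lemma ring_f: "ring \<f>"
proof (rule ringI)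
  show "abelian_group \<f>"
  proof (rule abelian_groupI)
    fix U assume "U \<in> carrier \<f>"
    then obtain x where "U = f_class x"
      by (auto simp: carrier_f)
    then have "f_class (- x) \<oplus>\<^bsub>\<f>\<^esub> U = \<zero>\<^bsub>\<f>\<^esub>"
      by (simp add: add_f_class zero_f)
    then show "\<exists>W\<in>carrier \<f>. W \<oplus>\<^bsub>\<f>\<^esub> U = \<zero>\<^bsub>\<f>\<^esub>"
      by (auto simp: carrier_f)
  qed (auto simp: carrier_f add_f_class zero_f ac_simps)
  show "Group.monoid \<f>"
    by (rule monoidI) (auto simp: carrier_f mult_f_class one_f mult.assoc)
qed (auto simp: carrier_f mult_f_class add_f_class distrib_left distrib_right)

lemma smult_f_class: "c \<odot>\<^bsub>\<f>\<^esub> f_class x = f_class (Poly_Mapping.single 0 c * x)"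
proof -
  have "f_class (Poly_Mapping.single 0 c * y) = f_class (Poly_Mapping.single 0 c * x)" if "y \<in> f_class x" for y
  proof -
    have "f_class y = f_class x"
      using A.a_repr_independence[OF that[unfolded f_class_def] _ J.a_subgroup] by (simp add: f_class_def)
    then show ?thesis
      by (simp flip: mult_f_class)
  qed
  moreover have "x \<in> f_class x"
    unfolding f_class_def by (rule J.a_rcos_self) simp
  ultimately have "(\<Union>y\<in>f_class x. f_class (Poly_Mapping.single 0 c * y)) = f_class (Poly_Mapping.single 0 c * x)"
    by blast
  then show ?thesis
    by (simp add: \<f>_def ring.defs module.defs)
qed

text \<open>
  The empty word is neutral for concatenation and the coefficients commute, so the scalars are
  central in the free algebra although the free monoid is not commutative.
\<close>

lemma single_0_central:
  fixes x :: "'i free_monoid \<Rightarrow>\<^sub>0 'b::comm_ring_1"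
  shows "x * Poly_Mapping.single 0 c = Poly_Mapping.single 0 c * x"
proof (induction x rule: update_induct)
  case (update f k v)
  then have "Poly_Mapping.update k v f = f + Poly_Mapping.single k v"
    by (intro poly_mapping_eqI) (auto simp: lookup_update lookup_add lookup_single when_def in_keys_iff)
  with update.IH show ?case
    by (simp add: distrib_left distrib_right mult_single mult.commute)
qed simp

lemma smult_mult_f:
  assumes "U \<in> carrier \<f>" "W \<in> carrier \<f>"
  shows "(c \<odot>\<^bsub>\<f>\<^esub> U) \<otimes>\<^bsub>\<f>\<^esub> W = c \<odot>\<^bsub>\<f>\<^esub> (U \<otimes>\<^bsub>\<f>\<^esub> W)"
    and "U \<otimes>\<^bsub>\<f>\<^esub> (c \<odot>\<^bsub>\<f>\<^esub> W) = c \<odot>\<^bsub>\<f>\<^esub> (U \<otimes>\<^bsub>\<f>\<^esub> W)"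
proof -
  obtain x y where "U = f_class x" "W = f_class y"
    using assms by (auto simp: carrier_f)
  moreover have "x * (Poly_Mapping.single 0 c * y) = Poly_Mapping.single 0 c * (x * y)"
    by (metis mult.assoc single_0_central)
  ultimately show "(c \<odot>\<^bsub>\<f>\<^esub> U) \<otimes>\<^bsub>\<f>\<^esub> W = c \<odot>\<^bsub>\<f>\<^esub> (U \<otimes>\<^bsub>\<f>\<^esub> W)"
    "U \<otimes>\<^bsub>\<f>\<^esub> (c \<odot>\<^bsub>\<f>\<^esub> W) = c \<odot>\<^bsub>\<f>\<^esub> (U \<otimes>\<^bsub>\<f>\<^esub> W)"
    by (simp_all add: smult_f_class mult_f_class mult.assoc)
qed

lemma module_f: "module ring_of_type_algebra \<f>"
proof (rule module_ring_of_type_algebraI)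
  show "abelian_group \<f>"
    using ring_f by (rule ring.is_abelian_group)
qed (auto simp: carrier_f smult_f_class add_f_class single_add distrib_left distrib_right mult_single
    simp flip: mult.assoc)

section \<open>The twistor at the two specializations\<close>

lemma module_ft: "module ring_of_type_algebra ft"
  unfolding ft_def by (rule module_tensor[OF module_f])

text \<open>
  \<open>\<Psi> (\<pi> x) = \<Psi> (\<pi> \<cdot> 1) * \<Psi> x = (- \<pi> \<cdot> 1) * \<Psi> x = - \<pi> \<Psi> x\<close>.  The last step uses that the twisted
  product is bilinear over the scalars and has the same unit as the original one.
\<close>

lemma twistor_pi_antilinear:
  assumes star: "twisted_product star" and \<Psi>: "twistor star \<Psi>" and x: "x \<in> carrier ft"
  shows "\<Psi> (pi_elem \<odot>\<^bsub>ft\<^esub> x) = (- pi_elem) \<odot>\<^bsub>ft\<^esub> \<Psi> x"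
proof -
  interpret ft: module ring_of_type_algebra ft
    by (rule module_ft)
  interpret T: ring "ft\<lparr>monoid.mult := star\<rparr>"
    using star by (simp add: twisted_product_def)
  have hom: "\<Psi> \<in> ring_hom ft (ft\<lparr>monoid.mult := star\<rparr>)"
    using \<Psi> by (simp add: twistor_def ring_iso_def)
  have \<Psi>x: "\<Psi> x \<in> carrier ft"
    using ring_hom_closed[OF hom x] by simp
  have one: "\<one>\<^bsub>ft\<^esub> \<in> carrier ft"
    using T.one_closed by simp
  have "\<Psi> (pi_elem \<odot>\<^bsub>ft\<^esub> x) = \<Psi> ((pi_elem \<odot>\<^bsub>ft\<^esub> \<one>\<^bsub>ft\<^esub>) \<otimes>\<^bsub>ft\<^esub> x)"
    using x scalar_mult_tensor[OF module_f ring_f smult_mult_f, of x ext pi_elem] by (simp add: ft_def)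
  also have "\<dots> = star (\<Psi> (pi_elem \<odot>\<^bsub>ft\<^esub> \<one>\<^bsub>ft\<^esub>)) (\<Psi> x)"
    using ring_hom_mult[OF hom _ x] one by simp
  also have "\<dots> = star ((- pi_elem) \<odot>\<^bsub>ft\<^esub> \<one>\<^bsub>ft\<^esub>) (\<Psi> x)"
    using \<Psi> by (simp add: twistor_def)
  also have "\<dots> = (- pi_elem) \<odot>\<^bsub>ft\<^esub> star \<one>\<^bsub>ft\<^esub> (\<Psi> x)"
    using star one \<Psi>x by (simp add: twisted_product_def)
  also have "star \<one>\<^bsub>ft\<^esub> (\<Psi> x) = \<Psi> x"
    using T.l_one \<Psi>x by simp
  finally show ?thesis .
qed

end

theorem corollary2p5:
  fixes form :: "'i::{finite, linorder} \<Rightarrow> 'i \<Rightarrow> int" and I1 :: "'i set"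
  assumes "super_cartan_datum form I1"
    and "super_cartan_datum.twisted_product form I1 star"
    and "super_cartan_datum.twistor form I1 star \<Psi>"
  defines "M \<equiv> super_cartan_datum.ft form I1"
  shows "\<exists>h. Qt_linear_iso (specialization 1 M) (specialization (- 1) M) h \<and>
    (\<forall>x\<in>carrier M. h (pure_tensor (eval_pi 1) M 1 x) = pure_tensor (eval_pi (- 1)) M 1 (\<Psi> x))"
proof -
  interpret super_cartan_datum form I1
    by fact
  have M: "module ring_of_type_algebra M"
    unfolding M_def by (rule module_ft)
  interpret M: module ring_of_type_algebra M
    by (fact M)
  have \<Psi>_iso: "\<Psi> \<in> iso (add_monoid M) (add_monoid M)"
    using assms(3) by (auto simp: M_def twistor_def ring_iso_def ring_hom_def iso_def hom_def)
  have \<Psi>_pi: "\<Psi> (pi_elem \<odot>\<^bsub>M\<^esub> x) = (- pi_elem) \<odot>\<^bsub>M\<^esub> \<Psi> x" if "x \<in> carrier M" for x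
    using that unfolding M_def by (rule twistor_pi_antilinear[OF assms(2,3)])
  obtain h where h: "h \<in> iso (add_monoid (specialization 1 M)) (add_monoid (specialization (- 1) M))"
    and h_descends: "\<forall>x\<in>carrier M. h (pure_tensor (eval_pi 1) M 1 x) = pure_tensor (eval_pi (- 1)) M 1 (\<Psi> x)"
    using specialization_iso_of_pi_antilinear[OF M M \<Psi>_iso \<Psi>_pi] by blast
  have h_\<Psi>: "h (pure_tensor (eval_pi 1) M 1 x) = pure_tensor (eval_pi (- 1)) M 1 (\<Psi> x)"
    if "x \<in> carrier M" for x
    using h_descends that by (rule bspec)
  have "h (Qt_Qvt c \<odot>\<^bsub>specialization 1 M\<^esub> U) = Qt_Qvt c \<odot>\<^bsub>specialization (- 1) M\<^esub> h U"
    if "U \<in> carrier (specialization 1 M)" for c U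
  proof -
    have "U \<in> pure_tensor (eval_pi 1) M 1 ` carrier M"
      using that by (simp add: specialization_map_surj[OF M])
    then obtain x where U: "U = pure_tensor (eval_pi 1) M 1 x" and x: "x \<in> carrier M"
      by (rule imageE)
    have \<Psi>x: "\<Psi> x \<in> carrier M"
      using assms(3) x by (auto simp: M_def twistor_def ring_iso_def ring_hom_def)
    have "h (Qt_Qvt c \<odot>\<^bsub>specialization 1 M\<^esub> U) = h (pure_tensor (eval_pi 1) M 1 (const (Qt_Qvt c) \<odot>\<^bsub>M\<^esub> x))"
      using x by (simp add: U specialization_map_smult[OF M])
    also have "\<dots> = pure_tensor (eval_pi (- 1)) M 1 (\<Psi> (const (Qt_Qvt c) \<odot>\<^bsub>M\<^esub> x))"
      using x M.smult_closed by (simp add: h_\<Psi>)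
    also have "\<Psi> (const (Qt_Qvt c) \<odot>\<^bsub>M\<^esub> x) = const (Qt_Qvt c) \<odot>\<^bsub>M\<^esub> \<Psi> x"
      using assms(3) x by (simp add: twistor_def M_def)
    also have "pure_tensor (eval_pi (- 1)) M 1 (const (Qt_Qvt c) \<odot>\<^bsub>M\<^esub> \<Psi> x) =
      Qt_Qvt c \<odot>\<^bsub>specialization (- 1) M\<^esub> pure_tensor (eval_pi (- 1)) M 1 (\<Psi> x)"
      using \<Psi>x by (simp add: specialization_map_smult[OF M])
    also have "pure_tensor (eval_pi (- 1)) M 1 (\<Psi> x) = h U"
      unfolding U by (rule h_\<Psi>[OF x, symmetric])
    finally show ?thesis .
  qed
  then have "Qt_linear_iso (specialization 1 M) (specialization (- 1) M) h"
    unfolding Qt_linear_iso_def using h by simp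
  then show ?thesis
    using h_descends by (intro exI[of _ h] conjI)
qed

end
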